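(* Let $\kappa\in(0,8)\setminus\mathbb{Q}$, $h=\frac{6-\kappa}{2\kappa}$, $q=e^{4\pi\mathrm{i}/\kappa}$, $[n]=\frac{q^n-q^{-n}}{q-q^{-1}}$, and $B=\frac{\Gamma(1-4/\kappa)^2}{\Gamma(2-8/\kappa)}$. Let $(\mathrm{u}_\alpha)_{\alpha\in\mathrm{DP}}$ be the unique collection of vectors, with $\mathrm{u}_\alpha\in\mathsf{H}^{(0)}_{2N}$ for $\alpha\in\mathrm{DP}_N$, such that $\mathrm{u}_{(0)}=1$ and for all $N\geq 1$, $\alpha\in\mathrm{DP}_N$ and $j\in\{1,\ldots,2N-1\}$ $$\hat\pi_j(\mathrm{u}_\alpha)=\begin{cases}0&\text{if }\alpha\text{ has a slope at }j,\\ \mathrm{u}_{\hat\alpha}&\text{if }\alpha\text{ has an up-wedge at }j,\\ -\frac{[\alpha(j)+1]}{[\alpha(j)+2]}\,\mathrm{u}_{\hat\alpha}&\text{if }\alpha\text{ has a down-wedge at }j,\end{cases}$$ where $\hat\alpha\in \mathrm{DP}_{N-1}$ is $\alpha$ with the wedge at $j$ removed. Let $\mathcal{F}:\mathsf{H}^{(0)}_{2N}\to\mathcal{S}_N$, $N\in\mathbb{Z}_{\ge0}$, be linear isomorphisms with the following property: for all $N\ge1$, $v\in\mathsf{H}^{(0)}_{2N}$, $j\in\{1,\ldots,2N-1\}$ and $\xi\in(x_{j-1},x_{j+2})$, $$\lim_{x_j,x_{j+1}\to\xi}\frac{\mathcal{F}[v](x_1,\ldots,x_{2N})}{(x_{j+1}-x_j)^{-2h}}=B\times\mathcal{F}[\hat\pi_j(v)](x_1,\ldots,x_{j-1},x_{j+2},\ldots,x_{2N}).$$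 Then the functions $$\mathcal{U}_\alpha:=\frac{1}{B^N}\,\mathcal{F}[\mathrm{u}_\alpha],\qquad \alpha\in\mathrm{DP}_N,\ N\in\mathbb{Z}_{\ge 0},$$ satisfy the following properties: (i) for all $j\in\{1,\ldots,2N\}$: $\Big[\frac{\kappa}{2}\frac{\partial^2}{\partial x_j^2}+\sum_{i\ne j}\Big(\frac{2}{x_i-x_j}\frac{\partial}{\partial x_i}-\frac{2h}{(x_i-x_j)^2}\Big)\Big]\mathcal{U}_\alpha(x_1,\ldots,x_{2N})=0$; (ii) $\mathcal{U}_\alpha(x_1,\ldots,x_{2N})=\prod_{i=1}^{2N}\mu'(x_i)^h\times\mathcal{U}_\alpha(\mu(x_1),\ldots,\mu(x_{2N}))$ for all $\mu(z)=\frac{az+b}{cz+d}$ with $a,b,c,d\in\mathbb{R}$, $ad-bc>0$, such that $\mu(x_1)<\cdots<\mu(x_{2N})$; (iii) for any $j\in\{1,\ldots,2N-1\}$ and $\xi\in(x_{j-1},x_{j+2})$, $$\lim_{x_j,x_{j+1}\to\xi}\frac{\mathcal{U}_\alpha(x_1,\ldots,x_{2N})}{(x_{j+1}-x_j)^{-2h}}=\begin{cases}0&\text{if }\alpha\text{ has a slope at }j,\\ \mathcal{U}_{\hat\alpha}(x_1,\ldots,x_{j-1},x_{j+2},\ldots,x_{2N})&\text{if }\alpha\text{ has an up-wedge at }j,\\ -\frac{[\alpha(j)+1]}{[\alpha(j)+2]}\,\mathcal{U}_{\hat\alpha}(x_1,\ldots,x_{j-1},x_{j+2},\ldots,x_{2N})&\text{if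 }\alpha\text{ has a down-wedge at }j.\end{cases}$$
   Context: **Dyck paths.** $\mathrm{DP}_N$ is the set of sequences $\alpha=(\alpha(0),\ldots,\alpha(2N))$ of non-negative integers with $|\alpha(j)-\alpha(j-1)|=1$ for all $j$ and $\alpha(0)=\alpha(2N)=0$; $\mathrm{DP}=\bigsqcup_{N\ge0}\mathrm{DP}_N$; $(0)$ is the only element of $\mathrm{DP}_0$. For $j\in\{1,\ldots,2N-1\}$, $\alpha$ has a *slope* at $j$ if $\alpha(j-1)\ne\alpha(j+1)$, an *up-wedge* at $j$ if $\alpha(j)=\alpha(j\pm1)+1$, a *down-wedge* at $j$ if $\alpha(j)=\alpha(j\pm1)-1$. Removing a wedge at $j$ gives $\hat\alpha=(\alpha(0),\ldots,\alpha(j-1),\alpha(j+2),\ldots,\alpha(2N))\in\mathrm{DP}_{N-1}$. **Quantum group.** $U_q(\mathfrak{sl}_2)$ is the $\mathbb{C}$-algebra generated by $K,K^{-1},E,F$ with relations $KK^{-1}=1=K^{-1}K$, $KE=q^2EK$, $KF=q^{-2}FK$, $EF-FE=\frac{K-K^{-1}}{q-q^{-1}}$, with coproduct $\Delta(E)=E\otimes K+1\otimes E$, $\Delta(K)=K\otimes K$, $\Delta(F)=F\otimes1+K^{-1}\otimes F$, used to define the action on tensor products. $\mathsf{M}_2$ is the two-dimensional representation with basis $\mathrm{e}_0,\mathrm{e}_1$: $K.\mathrm{e}_0=q\mathrm{e}_0$, $K.\mathrm{e}_1=q^{-1}\mathrm{e}_1$, $E.\mathrm{e}_0=0$, $E.\mathrm{e}_1=\mathrm{e}_0$,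 $F.\mathrm{e}_0=\mathrm{e}_1$, $F.\mathrm{e}_1=0$. Set $\mathsf{H}^{(0)}_{2N}=\{v\in\mathsf{M}_2^{\otimes 2N}: E.v=0,\ K.v=v\}$; for $N=0$, $\mathsf{M}_2^{\otimes0}=\mathsf{H}_0^{(0)}=\mathbb{C}$. The linear map $\hat\pi:\mathsf{M}_2\otimes\mathsf{M}_2\to\mathbb{C}$ is defined by $\hat\pi(\mathrm{s})=1$ for $\mathrm{s}=\frac{1}{q-q^{-1}}(\mathrm{e}_1\otimes\mathrm{e}_0-q\,\mathrm{e}_0\otimes\mathrm{e}_1)$ and $\hat\pi=0$ on $\mathrm{e}_0\otimes\mathrm{e}_0$, $q^{-1}\mathrm{e}_0\otimes\mathrm{e}_1+\mathrm{e}_1\otimes\mathrm{e}_0$, $\mathrm{e}_1\otimes\mathrm{e}_1$. On $\mathsf{M}_2^{\otimes n}$, $\hat\pi_j=\mathrm{id}^{\otimes(n-1-j)}\otimes\hat\pi\otimes\mathrm{id}^{\otimes(j-1)}:\mathsf{M}_2^{\otimes n}\to\mathsf{M}_2^{\otimes(n-2)}$ (tensor factors $j$ and $j+1$ counted from the right); it maps $\mathsf{H}_{2N}^{(0)}$ into $\mathsf{H}_{2(N-1)}^{(0)}$. The existence and uniqueness of the collection $(\mathrm{u}_\alpha)$ in the claim is an established fact. **Solution space.** $\mathfrak{X}_{2N}=\{(x_1,\ldots,x_{2N})\in\mathbb{R}^{2N}:x_1<\cdots<x_{2N}\}$, and $\mathcal{S}_N$ is the space of (twice continuously differentiable) functions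 $F:\mathfrak{X}_{2N}\to\mathbb{C}$ which satisfy the partial differential equations in (i) and the covariance in (ii) (with $F$ in place of $\mathcal{U}_\alpha$), and for which there exist constants $C,p>0$ with $|F(x_1,\ldots,x_{2N})|\le C\prod_{i<j}\max\big((x_j-x_i)^p,(x_j-x_i)^{-p}\big)$ on $\mathfrak{X}_{2N}$. For $N=0$, $\mathcal{S}_0=\mathbb{C}$. In limits $x_j,x_{j+1}\to\xi$ the other variables are fixed and $x_j<x_{j+1}$; conventions $x_0=-\infty$, $x_{2N+1}=+\infty$. **The maps $\mathcal{F}$.** It is known (from the "spin chain – Coulomb gas correspondence") that explicit linear isomorphisms $\mathcal{F}$ with the stated property exist, given by integrals of Coulomb gas type. *)

theory Defs
  imports "HOL-Analysis.Analysis"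
begin

section \<open>Dyck paths\<close>

text \<open>A Dyck path is the list of its values, so \<open>\<alpha> ! j\<close> is the height after \<open>j\<close> steps.\<close>

definition dyck_paths :: "nat \<Rightarrow> nat list set" where
  "dyck_paths N =
     {\<alpha>. length \<alpha> = 2 * N + 1 \<and> \<alpha> ! 0 = 0 \<and> \<alpha> ! (2 * N) = 0 \<and>
         (\<forall>j\<in>{1..2 * N}. \<bar>int (\<alpha> ! j) - int (\<alpha> ! (j - 1))\<bar> = 1)}"

definition has_slope :: "nat list \<Rightarrow> nat \<Rightarrow> bool" where
  "has_slope \<alpha> j \<longleftrightarrow> \<alpha> ! (j - 1) \<noteq> \<alpha> ! (j + 1)"

definition has_up_wedge :: "nat list \<Rightarrow> nat \<Rightarrow> bool" where
  "has_up_wedge \<alpha> j \<longleftrightarrow> \<alpha> ! j = \<alpha> ! (j - 1) + 1 \<and> \<alpha> ! j = \<alpha> ! (j + 1) + 1"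

definition has_down_wedge :: "nat list \<Rightarrow> nat \<Rightarrow> bool" where
  "has_down_wedge \<alpha> j \<longleftrightarrow> \<alpha> ! j + 1 = \<alpha> ! (j - 1) \<and> \<alpha> ! j + 1 = \<alpha> ! (j + 1)"

definition remove_wedge :: "nat \<Rightarrow> nat list \<Rightarrow> nat list" where
  "remove_wedge j \<alpha> = take j \<alpha> @ drop (j + 2) \<alpha>"


section \<open>The quantum group action on tensor powers of \<open>M\<^sub>2\<close>\<close>

text \<open>
  The basis vector \<open>e\<^sub>0\<close> of \<open>M\<^sub>2\<close> is encoded by \<^const>\<open>False\<close> and \<open>e\<^sub>1\<close> by \<^const>\<open>True\<close>.
  An element of the \<open>n\<close>-th tensor power is its coefficient function on words of length \<open>n\<close>,
  extended by zero to all other words; the head of a word is the leftmost tensor factor, and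
  \<open>ket [b\<^sub>1, \<dots>, b\<^sub>n]\<close> is the basis vector given by the tensor product of the \<open>e\<close>'s named by
  \<open>b\<^sub>1, \<dots>, b\<^sub>n\<close> in that order.
\<close>

type_synonym tensor = "bool list \<Rightarrow> complex"

definition tensor_power :: "nat \<Rightarrow> tensor set" where
  "tensor_power n = {v. \<forall>w. length w \<noteq> n \<longrightarrow> v w = 0}"

definition ket :: "bool list \<Rightarrow> tensor" where
  "ket w = (\<lambda>w'. if w' = w then 1 else 0)"

datatype uq_gen = UK | UKinv | UE | UF

text \<open>\<open>M2_coeff q g c b\<close> is the coefficient of \<open>e\<^sub>c\<close> in \<open>g.e\<^sub>b\<close>.\<close>

fun M2_coeff :: "complex \<Rightarrow> uq_gen \<Rightarrow> bool \<Rightarrow> bool \<Rightarrow> complex" where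
  "M2_coeff q UK c b = (if c = b then (if b then inverse q else q) else 0)"
| "M2_coeff q UKinv c b = (if c = b then (if b then q else inverse q) else 0)"
| "M2_coeff q UE c b = (if b \<and> \<not> c then 1 else 0)"
| "M2_coeff q UF c b = (if \<not> b \<and> c then 1 else 0)"

definition id_coeff :: "bool \<Rightarrow> bool \<Rightarrow> complex" where
  "id_coeff c b = (if c = b then 1 else 0)"

text \<open>
  \<open>tensor_op A T\<close> is the tensor product of operators \<open>A \<otimes> T\<close>, for a matrix \<open>A\<close> acting on
  \<open>M\<^sub>2\<close> (leftmost factor) and an operator \<open>T\<close> acting on the remaining factors.
\<close>

definition tensor_op :: "(bool \<Rightarrow> bool \<Rightarrow> complex) \<Rightarrow> (tensor \<Rightarrow> tensor) \<Rightarrow> tensor \<Rightarrow> tensor" where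
  "tensor_op A T v =
     (\<lambda>w. case w of [] \<Rightarrow> 0
          | c # w' \<Rightarrow> (\<Sum>b\<in>UNIV. A c b * T (\<lambda>w''. v (b # w'')) w'))"

text \<open>
  Action of the generators on the \<open>n\<close>-th tensor power, which is \<open>M\<^sub>2\<close> tensored with the
  \<open>(n - 1)\<close>-st one.  The equations for \<open>Suc n\<close> are the coproduct
  \<open>\<Delta>(K) = K \<otimes> K\<close>, \<open>\<Delta>(K\<^sup>-\<^sup>1) = K\<^sup>-\<^sup>1 \<otimes> K\<^sup>-\<^sup>1\<close>, \<open>\<Delta>(E) = E \<otimes> K + 1 \<otimes> E\<close>,
  \<open>\<Delta>(F) = F \<otimes> 1 + K\<^sup>-\<^sup>1 \<otimes> F\<close>; those for \<open>0\<close> are the trivial representation (counit).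
\<close>

fun uq_act :: "complex \<Rightarrow> nat \<Rightarrow> uq_gen \<Rightarrow> tensor \<Rightarrow> tensor" where
  "uq_act q 0 UK v = v"
| "uq_act q 0 UKinv v = v"
| "uq_act q 0 UE v = (\<lambda>w. 0)"
| "uq_act q 0 UF v = (\<lambda>w. 0)"
| "uq_act q (Suc n) UK v = tensor_op (M2_coeff q UK) (uq_act q n UK) v"
| "uq_act q (Suc n) UKinv v = tensor_op (M2_coeff q UKinv) (uq_act q n UKinv) v"
| "uq_act q (Suc n) UE v =
     (\<lambda>w. tensor_op (M2_coeff q UE) (uq_act q n UK) v w
        + tensor_op id_coeff (uq_act q n UE) v w)"
| "uq_act q (Suc n) UF v =
     (\<lambda>w. tensor_op (M2_coeff q UF) (\<lambda>x. x) v w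
        + tensor_op (M2_coeff q UKinv) (uq_act q n UF) v w)"

text \<open>The space \<open>H\<^sup>(\<^sup>0\<^sup>)\<close> inside the \<open>n\<close>-th tensor power (used for even \<open>n\<close>).\<close>

definition H0 :: "complex \<Rightarrow> nat \<Rightarrow> tensor set" where
  "H0 q n = {v \<in> tensor_power n. uq_act q n UE v = (\<lambda>w. 0) \<and> uq_act q n UK v = v}"

definition singlet :: "complex \<Rightarrow> tensor" where
  "singlet q = (\<lambda>w. 1 / (q - inverse q) * (ket [True, False] w - q * ket [False, True] w))"

definition is_pi_hat :: "complex \<Rightarrow> (tensor \<Rightarrow> complex) \<Rightarrow> bool" where
  "is_pi_hat q p \<longleftrightarrow>
     (\<forall>v\<in>tensor_power 2. \<forall>v'\<in>tensor_power 2. \<forall>a b.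
        p (\<lambda>w. a * v w + b * v' w) = a * p v + b * p v') \<and>
     p (singlet q) = 1 \<and>
     p (ket [False, False]) = 0 \<and>
     p (\<lambda>w. inverse q * ket [False, True] w + ket [True, False] w) = 0 \<and>
     p (ket [True, True]) = 0"

text \<open>Values outside \<open>tensor_power 2\<close> are normalised, which makes the description unique.\<close>

definition pi_hat :: "complex \<Rightarrow> tensor \<Rightarrow> complex" where
  "pi_hat q = (THE p. p \<in> extensional (tensor_power 2) \<and> is_pi_hat q p)"

text \<open>
  \<open>id \<otimes> \<pi> \<otimes> id\<close> on the \<open>n\<close>-th tensor power with \<open>n - 1 - j\<close> identity factors on the left
  and \<open>j - 1\<close> on the right: the coefficient of the result at a word \<open>w\<close> is obtained by
  applying \<^const>\<open>pi_hat\<close> to the two factors inserted after the first \<open>n - 1 - j\<close> letters.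
\<close>

definition pi_hat_at :: "complex \<Rightarrow> nat \<Rightarrow> nat \<Rightarrow> tensor \<Rightarrow> tensor" where
  "pi_hat_at q n j v =
     (\<lambda>w. if length w = n - 2
          then pi_hat q (\<lambda>z. v (take (n - 1 - j) w @ z @ drop (n - 1 - j) w)) else 0)"

definition qnum :: "complex \<Rightarrow> nat \<Rightarrow> complex" where
  "qnum q n = (q ^ n - inverse q ^ n) / (q - inverse q)"

definition wedge_vectors :: "complex \<Rightarrow> (nat list \<Rightarrow> tensor) \<Rightarrow> bool" where
  "wedge_vectors q u \<longleftrightarrow>
     (\<forall>N. \<forall>\<alpha>\<in>dyck_paths N. u \<alpha> \<in> H0 q (2 * N)) \<and>
     u [0] = ket [] \<and>
     (\<forall>N\<ge>1. \<forall>\<alpha>\<in>dyck_paths N. \<forall>j\<in>{1..2 * N - 1}.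
        (has_slope \<alpha> j \<longrightarrow> pi_hat_at q (2 * N) j (u \<alpha>) = (\<lambda>w. 0)) \<and>
        (has_up_wedge \<alpha> j \<longrightarrow> pi_hat_at q (2 * N) j (u \<alpha>) = u (remove_wedge j \<alpha>)) \<and>
        (has_down_wedge \<alpha> j \<longrightarrow>
           pi_hat_at q (2 * N) j (u \<alpha>) =
             (\<lambda>w. - (qnum q (\<alpha> ! j + 1) / qnum q (\<alpha> ! j + 2)) * u (remove_wedge j \<alpha>) w)))"


section \<open>The solution space\<close>

text \<open>
  A point of \<open>\<real>\<^sup>n\<close> is a function on the index set \<open>{1..n}\<close>, equal to \<^const>\<open>undefined\<close>
  elsewhere; the product topology on \<^typ>\<open>nat \<Rightarrow> real\<close> induces the Euclidean topology
  on these points.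
\<close>

definition chamber :: "nat \<Rightarrow> (nat \<Rightarrow> real) set" where
  "chamber n = {x \<in> {1..n} \<rightarrow>\<^sub>E UNIV. strict_mono_on {1..n} x}"

definition partial_deriv :: "nat \<Rightarrow> ((nat \<Rightarrow> real) \<Rightarrow> complex) \<Rightarrow> (nat \<Rightarrow> real) \<Rightarrow> complex" where
  "partial_deriv i f x = vector_derivative (\<lambda>t. f (x(i := t))) (at (x i))"

definition C1_on_chamber :: "nat \<Rightarrow> ((nat \<Rightarrow> real) \<Rightarrow> complex) \<Rightarrow> bool" where
  "C1_on_chamber n f \<longleftrightarrow>
     continuous_on (chamber n) f \<and>
     (\<forall>i\<in>{1..n}. (\<forall>x\<in>chamber n. (\<lambda>t. f (x(i := t))) differentiable (at (x i))) \<and>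
                 continuous_on (chamber n) (partial_deriv i f))"

definition C2_on_chamber :: "nat \<Rightarrow> ((nat \<Rightarrow> real) \<Rightarrow> complex) \<Rightarrow> bool" where
  "C2_on_chamber n f \<longleftrightarrow>
     C1_on_chamber n f \<and> (\<forall>i\<in>{1..n}. C1_on_chamber n (partial_deriv i f))"

definition satisfies_PDEs ::
    "real \<Rightarrow> real \<Rightarrow> nat \<Rightarrow> ((nat \<Rightarrow> real) \<Rightarrow> complex) \<Rightarrow> bool" where
  "satisfies_PDEs \<kappa> h n f \<longleftrightarrow>
     (\<forall>j\<in>{1..n}. \<forall>x\<in>chamber n.
        of_real (\<kappa> / 2) * partial_deriv j (partial_deriv j f) x
        + (\<Sum>i\<in>{1..n} - {j}. of_real (2 / (x i - x j)) * partial_deriv i f x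
                             - of_real (2 * h / (x i - x j)\<^sup>2) * f x) = 0)"

definition moebius :: "real \<Rightarrow> real \<Rightarrow> real \<Rightarrow> real \<Rightarrow> real \<Rightarrow> real" where
  "moebius a b c d z = (a * z + b) / (c * z + d)"

text \<open>
  The condition \<open>c * x i + d \<noteq> 0\<close> says that the images of the \<open>x i\<close> are finite; it has to be
  explicit because division by zero is total.
\<close>

definition satisfies_COV :: "real \<Rightarrow> nat \<Rightarrow> ((nat \<Rightarrow> real) \<Rightarrow> complex) \<Rightarrow> bool" where
  "satisfies_COV h n f \<longleftrightarrow>
     (\<forall>a b c d. \<forall>x\<in>chamber n.
        a * d - b * c > 0 \<longrightarrow>
        (\<forall>i\<in>{1..n}. c * x i + d \<noteq> 0) \<longrightarrow>
        (\<lambda>i\<in>{1..n}. moebius a b c d (x i)) \<in> chamber n \<longrightarrow>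
        f x = of_real (\<Prod>i\<in>{1..n}. deriv (moebius a b c d) (x i) powr h)
              * f (\<lambda>i\<in>{1..n}. moebius a b c d (x i)))"

definition power_law_bound :: "nat \<Rightarrow> ((nat \<Rightarrow> real) \<Rightarrow> complex) \<Rightarrow> bool" where
  "power_law_bound n f \<longleftrightarrow>
     (\<exists>C>0. \<exists>p>0. \<forall>x\<in>chamber n.
        norm (f x) \<le> C * (\<Prod>(i, j)\<in>{(i, j). 1 \<le> i \<and> i < j \<and> j \<le> n}.
                             max ((x j - x i) powr p) ((x j - x i) powr (- p))))"

text \<open>
  A function on the chamber is represented by its extension by zero, so that equality of
  functions and the pointwise vector space operations are those of functions on the chamber.
\<close>

definition solution_space ::
    "real \<Rightarrow> real \<Rightarrow> nat \<Rightarrow> ((nat \<Rightarrow> real) \<Rightarrow> complex) set" where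
  "solution_space \<kappa> h N =
     {f. (\<forall>x. x \<notin> chamber (2 * N) \<longrightarrow> f x = 0) \<and>
         C2_on_chamber (2 * N) f \<and> satisfies_PDEs \<kappa> h (2 * N) f \<and>
         satisfies_COV h (2 * N) f \<and> power_law_bound (2 * N) f}"

definition linear_iso :: "('a \<Rightarrow> complex) set \<Rightarrow> ('b \<Rightarrow> complex) set \<Rightarrow>
    (('a \<Rightarrow> complex) \<Rightarrow> ('b \<Rightarrow> complex)) \<Rightarrow> bool" where
  "linear_iso V W T \<longleftrightarrow>
     bij_betw T V W \<and>
     (\<forall>v\<in>V. \<forall>v'\<in>V. T (\<lambda>w. v w + v' w) = (\<lambda>x. T v x + T v' x)) \<and>
     (\<forall>c. \<forall>v\<in>V. T (\<lambda>w. c * v w) = (\<lambda>x. c * T v x))"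


section \<open>Fusion limits\<close>

definition remove_pair :: "nat \<Rightarrow> (nat \<Rightarrow> real) \<Rightarrow> nat \<Rightarrow> real" where
  "remove_pair j x = (\<lambda>i. if i < j then x i else x (i + 2))"

text \<open>
  The limit of \<open>f (x\<^sub>1, \<dots>, x\<^sub>n) / (x\<^sub>j\<^sub>+\<^sub>1 - x\<^sub>j)\<^sup>-\<^sup>2\<^sup>h\<close> as \<open>x\<^sub>j, x\<^sub>j\<^sub>+\<^sub>1\<close> (here \<open>s < t\<close>) tend to \<open>\<xi>\<close>
  is \<open>g (x\<^sub>1, \<dots>, x\<^sub>j\<^sub>-\<^sub>1, x\<^sub>j\<^sub>+\<^sub>2, \<dots>, x\<^sub>n)\<close>.  Only the coordinates of \<open>x\<close> other than
  \<open>j, j + 1\<close> matter: those two are overwritten by \<open>s, t\<close> or removed.  The two guards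
  express that \<open>\<xi>\<close> lies strictly between \<open>x\<^sub>j\<^sub>-\<^sub>1\<close> and \<open>x\<^sub>j\<^sub>+\<^sub>2\<close>, with \<open>x\<^sub>0 = -\<infinity>\<close> and \<open>x\<^sub>n\<^sub>+\<^sub>1 = \<infinity>\<close>.
\<close>

definition has_fusion_limit :: "real \<Rightarrow> nat \<Rightarrow> nat \<Rightarrow>
    ((nat \<Rightarrow> real) \<Rightarrow> complex) \<Rightarrow> ((nat \<Rightarrow> real) \<Rightarrow> complex) \<Rightarrow> bool" where
  "has_fusion_limit h n j f g \<longleftrightarrow>
     (\<forall>x\<in>chamber n. \<forall>\<xi>.
        (1 < j \<longrightarrow> x (j - 1) < \<xi>) \<longrightarrow> (j + 2 \<le> n \<longrightarrow> \<xi> < x (j + 2)) \<longrightarrow>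
        ((\<lambda>(s, t). f (x(j := s, j + 1 := t)) / of_real ((t - s) powr (- 2 * h)))
           \<longlongrightarrow> g (remove_pair j x)) (at (\<xi>, \<xi>) within {(s, t). s < t}))"


section \<open>Well-definedness checks\<close>

lemma uq_act_lin:
  "uq_act q n g (\<lambda>w. a * v w + b * v' w) = (\<lambda>w. a * uq_act q n g v w + b * uq_act q n g v' w)"
proof (induction n arbitrary: g v v')
  case 0
  show ?case by (cases g) auto
next
  case (Suc n)
  show ?case
  proof
    fix w
    show "uq_act q (Suc n) g (\<lambda>w. a * v w + b * v' w) w
        = a * uq_act q (Suc n) g v w + b * uq_act q (Suc n) g v' w"
      by (cases g; cases w)
         (auto simp: tensor_op_def Suc.IH UNIV_bool id_coeff_def algebra_simps)
  qed
qed

lemma uq_act_scale: "uq_act q n g (\<lambda>w. a * v w) = (\<lambda>w. a * uq_act q n g v w)"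
  using uq_act_lin[of q n g a v 0 v] by simp

lemma uq_act_add: "uq_act q n g (\<lambda>w. v w + v' w) = (\<lambda>w. uq_act q n g v w + uq_act q n g v' w)"
  using uq_act_lin[of q n g 1 v 1 v'] by simp

text \<open>The operators satisfy the defining relations of \<open>U\<^sub>q(sl\<^sub>2)\<close> on every tensor power.\<close>

lemma uq_act_relations:
  assumes "q \<noteq> 0"
  shows "\<And>w v. length w = n \<Longrightarrow> uq_act q n UK (uq_act q n UKinv v) w = v w"
    and "\<And>w v. length w = n \<Longrightarrow> uq_act q n UKinv (uq_act q n UK v) w = v w"
    and "\<And>w v. length w = n \<Longrightarrow> uq_act q n UK (uq_act q n UE v) w = q\<^sup>2 * uq_act q n UE (uq_act q n UK v) w"
    and "\<And>w v. length w = n \<Longrightarrow> uq_act q n UK (uq_act q n UF v) w = inverse (q\<^sup>2) * uq_act q n UF (uq_act q n UK v) w"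
    and "\<And>w v. length w = n \<Longrightarrow> q\<^sup>2 \<noteq> 1 \<Longrightarrow> uq_act q n UE (uq_act q n UF v) w - uq_act q n UF (uq_act q n UE v) w
         = (uq_act q n UK v w - uq_act q n UKinv v w) / (q - inverse q)"
proof (induction n)
  case 0
  { case 1 show ?case by simp }
  { case 2 show ?case by simp }
  { case 3 then show ?case by simp }
  { case 4 then show ?case by simp }
  { case 5 then show ?case by simp }
next
  case (Suc n)
  note S = tensor_op_def UNIV_bool id_coeff_def uq_act_scale uq_act_add
  { case (1 w v) then show ?case using assms Suc.IH(1) by (cases w) (auto simp: S) }
  { case (2 w v) then show ?case using assms Suc.IH(2) by (cases w) (auto simp: S) }
  { case (3 w v) then show ?case using assms Suc.IH(3) by (cases w) (auto simp: S power2_eq_square field_simps) }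
  { case (4 w v) then show ?case using assms Suc.IH(4) by (cases w) (auto simp: S power2_eq_square field_simps) }
  { case (5 w v)
    then obtain c w' where w: "w = c # w'" "length w' = n" by (cases w) auto
    have d: "q - inverse q \<noteq> 0" using 5 assms by (auto simp: power2_eq_square field_simps)
    have i4: "uq_act q n UF (uq_act q n UK v) w' = q\<^sup>2 * uq_act q n UK (uq_act q n UF v) w'" for v
      using Suc.IH(4)[OF w(2), of v] assms by (simp add: field_simps)
    have i5: "uq_act q n UE (uq_act q n UF v) w' = uq_act q n UF (uq_act q n UE v) w'
         + (uq_act q n UK v w' - uq_act q n UKinv v w') / (q - inverse q)" for v
      using Suc.IH(5)[OF w(2) 5(2), of v] by (simp add: algebra_simps)
    have qq: "q * q \<noteq> 1" using 5 by (simp add: power2_eq_square)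
    show ?case unfolding w using d assms qq
      by (cases c; simp add: S i4 i5; simp add: field_simps power2_eq_square) }
qed

lemma word2: "length w = 2 \<Longrightarrow> w \<in> {[a,b] | a b. True}"
  by (auto simp: numeral_2_eq_2 length_Suc_conv)

lemma tp2_eq:
  assumes "v \<in> tensor_power 2" "v' \<in> tensor_power 2" "\<And>a b. v [a,b] = v' [a,b]"
  shows "v = v'"
proof
  fix w show "v w = v' w"
    using assms word2[of w] by (cases "length w = 2") (auto simp: tensor_power_def)
qed

lemma tp2_lin: "v \<in> tensor_power 2 \<Longrightarrow> v' \<in> tensor_power 2 \<Longrightarrow> (\<lambda>w. a * v w + b * v' w) \<in> tensor_power 2"
  by (auto simp: tensor_power_def)

lemma tp2_ket: "ket [a,b] \<in> tensor_power 2"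
  by (auto simp: tensor_power_def ket_def)

lemma pi_hat_formula:
  assumes q: "q \<noteq> 0" "q\<^sup>2 \<noteq> 1" "q\<^sup>2 \<noteq> -1" and p: "is_pi_hat q p" and v: "v \<in> tensor_power 2"
  shows "p v = (q - inverse q) / (q + inverse q) * (inverse q * v [True, False] - v [False, True])"
proof -
  let ?t = "\<lambda>w. inverse q * ket [False, True] w + 1 * ket [True, False] w"
  define al where "al = (q * v [True,False] + v [False,True]) / (q + inverse q)"
  define be where "be = (q - inverse q) / (q + inverse q) * (inverse q * v [True, False] - v [False, True])"
  have d: "q - inverse q \<noteq> 0" using q by (auto simp: power2_eq_square field_simps)
  have e: "q + inverse q \<noteq> 0" using q by (auto simp: power2_eq_square field_simps add_eq_0_iff)
  have t: "?t \<in> tensor_power 2" by (intro tp2_lin tp2_ket)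
  have s: "singlet q \<in> tensor_power 2" by (auto simp: tensor_power_def ket_def singlet_def)
  have L: "p (\<lambda>w. a * x w + b * y w) = a * p x + b * p y"
    if "x \<in> tensor_power 2" "y \<in> tensor_power 2" for a b x y
    using p that by (auto simp: is_pi_hat_def)
  define v1 where "v1 = (\<lambda>w. v [False,False] * ket [False,False] w + v [True,True] * ket [True,True] w)"
  define v2 where "v2 = (\<lambda>w. al * ?t w + be * singlet q w)"
  have v12: "v1 \<in> tensor_power 2" "v2 \<in> tensor_power 2"
    unfolding v1_def v2_def by (intro tp2_lin tp2_ket s t)+
  have "q * (q * (q * q)) \<noteq> 1"
  proof
    assume "q * (q * (q * q)) = 1"
    then have "(q\<^sup>2 - 1) * (q\<^sup>2 + 1) = 0" by (simp add: power2_eq_square algebra_simps)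
    then show False using q by (simp add: add_eq_0_iff2)
  qed
  have "v = (\<lambda>w. 1 * v1 w + 1 * v2 w)"
  proof (rule tp2_eq)
    show "(\<lambda>w. 1 * v1 w + 1 * v2 w) \<in> tensor_power 2" by (intro tp2_lin v12)
    fix a b
    have "inverse q * al - q * (be / (q - inverse q)) = v [False,True]"
      unfolding al_def be_def using d e q(1)
      by (simp add: divide_simps) (simp add: algebra_simps power2_eq_square)
    moreover have "al + be / (q - inverse q) = v [True, False]"
      unfolding al_def be_def using d e q(1)
      by (simp add: divide_simps) (simp add: algebra_simps power2_eq_square)
    ultimately show "v [a,b] = 1 * v1 [a,b] + 1 * v2 [a,b]"
      by (cases a; cases b) (simp_all add: v1_def v2_def ket_def singlet_def field_simps)
  qed (use v in auto)
  then have "p v = 1 * p v1 + 1 * p v2"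
    using L[OF v12, of 1 1] by metis
  also have "p v1 = 0" unfolding v1_def L[OF tp2_ket tp2_ket] using p by (simp add: is_pi_hat_def)
  also have "p v2 = be" unfolding v2_def L[OF t s] using p by (simp add: is_pi_hat_def)
  finally show ?thesis by (simp add: be_def)
qed

lemma pi_hat_exists:
  assumes q: "q \<noteq> 0" "q\<^sup>2 \<noteq> 1" "q\<^sup>2 \<noteq> -1"
  shows "is_pi_hat q (\<lambda>v\<in>tensor_power 2. (q - inverse q) / (q + inverse q) * (inverse q * v [True, False] - v [False, True]))"
proof -
  have d: "q - inverse q \<noteq> 0" using q by (auto simp: power2_eq_square field_simps)
  have e: "q + inverse q \<noteq> 0" using q by (auto simp: power2_eq_square field_simps add_eq_0_iff)
  have t: "(\<lambda>w. inverse q * ket [False, True] w + ket [True, False] w) \<in> tensor_power 2"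
    by (auto simp: tensor_power_def ket_def)
  have s: "singlet q \<in> tensor_power 2" by (auto simp: tensor_power_def ket_def singlet_def)
  have "singlet q [True, False] = 1 / (q - inverse q)" "singlet q [False, True] = - q / (q - inverse q)"
    by (simp_all add: singlet_def ket_def)
  then have "inverse q * singlet q [True, False] - singlet q [False, True] = (q + inverse q) / (q - inverse q)"
    by (simp add: diff_divide_distrib add_divide_distrib)
  then have "(q - inverse q) / (q + inverse q) * (inverse q * singlet q [True, False] - singlet q [False, True]) = 1"
    using d e by simp
  moreover define C where "C = (q - inverse q) / (q + inverse q)"
  ultimately have C: "C * (inverse q * singlet q [True, False] - singlet q [False, True]) = 1"
    by simp
  show ?thesis
    unfolding is_pi_hat_def C_def[symmetric] using s t C
    by (simp add: tp2_ket tp2_lin) (simp add: ket_def algebra_simps)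
qed

lemma pi_hat_ex1:
  assumes "q \<noteq> 0" "q\<^sup>2 \<noteq> 1" "q\<^sup>2 \<noteq> -1"
  shows "\<exists>!p. p \<in> extensional (tensor_power 2) \<and> is_pi_hat q p"
proof (rule ex_ex1I)
  show "\<exists>p. p \<in> extensional (tensor_power 2) \<and> is_pi_hat q p"
    using pi_hat_exists[OF assms] by (intro exI conjI) auto
next
  fix p p' assume "p \<in> extensional (tensor_power 2) \<and> is_pi_hat q p" "p' \<in> extensional (tensor_power 2) \<and> is_pi_hat q p'"
  then show "p = p'" using pi_hat_formula[OF assms, of p] pi_hat_formula[OF assms, of p'] by (intro extensionalityI[of p "tensor_power 2" p']) simp_all
qed

text \<open>
  The parameter \<open>q\<close> is not a root of unity for irrational \<open>\<kappa>\<close>, so the hypotheses on \<open>q\<close>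
  in the preceding lemmas hold.
\<close>

lemma q_root:
  assumes "\<kappa> \<notin> \<rat>" "n > 0"
  shows "exp (4 * of_real pi * \<i> / of_real \<kappa>) ^ n \<noteq> 1"
proof
  assume "exp (4 * of_real pi * \<i> / of_real \<kappa>) ^ n = 1"
  then have "exp (of_nat n * (4 * of_real pi * \<i> / of_real \<kappa>)) = 1"
    by (simp only: exp_of_nat_mult)
  then obtain m :: int where "of_nat n * (4 * pi / \<kappa>) = of_int (2 * m) * pi"
    by (auto simp: exp_eq_1 Im_divide_of_real)
  then have "pi * (real n * 4 / \<kappa>) = pi * (2 * of_int m)" by (simp add: algebra_simps)
  then have m: "real n * 4 / \<kappa> = 2 * of_int m" unfolding mult_cancel_left by simp
  have k: "\<kappa> \<noteq> 0" using assms by auto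
  with m assms(2) have "m \<noteq> 0" by auto
  with m k have "\<kappa> = real n * 4 / (2 * of_int m)" by (simp add: field_simps)
  then have "\<kappa> \<in> \<rat>" by simp
  with assms show False by simp
qed

end

theory Submission
  imports Defs
begin

text \<open>
  By linearity \<open>\<U> \<alpha> = \<F> [B\<^sup>-\<^sup>N u \<alpha>]\<close> lies in the solution space, which contains (i) and (ii).
  For (iii), the factor \<open>B\<close> produced by the fusion limit of \<open>\<F>\<close> is absorbed by lowering the
  normalisation from \<open>B\<^sup>-\<^sup>N\<close> to \<open>B\<^sup>-\<^sup>(\<^sup>N\<^sup>-\<^sup>1\<^sup>)\<close>, and the remaining factor is read off the projections
  of \<open>u \<alpha>\<close>.  This needs \<open>B \<noteq> 0\<close>, which holds because irrationality of \<open>\<kappa>\<close> keeps the arguments of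
  the Gamma functions away from the poles.
\<close>

lemma zero_in_H0: "(\<lambda>w. 0) \<in> H0 q n"
  using uq_act_scale[of q n _ 0 "\<lambda>w. 0"] by (simp add: H0_def tensor_power_def)

lemma scale_in_H0: "v \<in> H0 q n \<Longrightarrow> (\<lambda>w. c * v w) \<in> H0 q n"
  by (auto simp: H0_def tensor_power_def uq_act_scale)

lemma linear_iso_scale:
  "linear_iso V W T \<Longrightarrow> v \<in> V \<Longrightarrow> T (\<lambda>w. c * v w) = (\<lambda>x. c * T v x)"
  by (simp add: linear_iso_def)

lemma linear_iso_mem: "linear_iso V W T \<Longrightarrow> v \<in> V \<Longrightarrow> T v \<in> W"
  by (auto simp: linear_iso_def bij_betw_def)

text \<open>Serves the slope case. \<open>linear_iso\<close> gives homogeneity only on the domain,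
  so the zero tensor must first be known to lie in \<open>H0\<close>; then scaling it by 0
  suffices.\<close>

lemma linear_iso_H0_zero: "linear_iso (H0 q n) W T \<Longrightarrow> T (\<lambda>w. 0) = (\<lambda>x. 0)"
  using linear_iso_scale[OF _ zero_in_H0, of q n W T 0] by simp

text \<open>The only new adjacency joins the heights at \<open>j - 1\<close> and
  \<open>j + 2\<close>. As the heights at \<open>j - 1\<close> and \<open>j + 1\<close> agree, it is
  the old step from \<open>j + 1\<close> to \<open>j + 2\<close>. Up-wedges and down-wedges are thus
  treated at once.\<close>

lemma remove_wedge_dyck:
  assumes \<alpha>: "\<alpha> \<in> dyck_paths N" and j: "j \<in> {1..2 * N - 1}"
    and wedge: "\<alpha> ! (j - 1) = \<alpha> ! (j + 1)"
  shows "remove_wedge j \<alpha> \<in> dyck_paths (N - 1)"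
proof -
  have len: "length \<alpha> = 2 * N + 1" and ends: "\<alpha> ! 0 = 0" "\<alpha> ! (2 * N) = 0"
    and step: "\<And>k. k \<in> {1..2 * N} \<Longrightarrow> \<bar>int (\<alpha> ! k) - int (\<alpha> ! (k - 1))\<bar> = 1"
    using \<alpha> by (auto simp: dyck_paths_def)
  have N: "N \<ge> 1" and jN: "1 \<le> j" "j < 2 * N"
    using j by auto
  have nth: "remove_wedge j \<alpha> ! i = (if i < j then \<alpha> ! i else \<alpha> ! (i + 2))"
    if "i \<le> 2 * (N - 1)" for i
    using that len jN by (auto simp: remove_wedge_def nth_append min_def add.commute)
  have last: "remove_wedge j \<alpha> ! (2 * (N - 1)) = 0"
  \<comment> \<open>For a wedge at the very end the final entry itself is deleted; the new last
    height is that at \<open>j - 1\<close>, which \<open>wedge\<close> equates with the old final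
    0.\<close>
  proof (cases "j = 2 * N - 1")
    case True
    then have "j - 1 = 2 * (N - 1)" "j + 1 = 2 * N" "2 * (N - 1) < j"
      using N by auto
    then show ?thesis using nth[of "2 * (N - 1)"] wedge ends by simp
  next
    case False
    then have "\<not> 2 * (N - 1) < j" "2 * (N - 1) + 2 = 2 * N"
      using N jN by auto
    then show ?thesis using nth[of "2 * (N - 1)"] ends by simp
  qed
  have "\<bar>int (remove_wedge j \<alpha> ! k) - int (remove_wedge j \<alpha> ! (k - 1))\<bar> = 1"
    if k: "k \<in> {1..2 * (N - 1)}" for k
  proof -
    consider "k < j" | "k = j" | "j < k" by linarith
    then show ?thesis
    proof cases
      case 1
      then show ?thesis using k step[of k] nth[of k] nth[of "k - 1"] by auto
    next
      case 2
      then show ?thesis using k jN wedge step[of "j + 2"] nth[of j] nth[of "j - 1"] by auto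
    next
      case 3
      \<comment> \<open>Aligns the index from \<open>nth\<close> with the one from
        \<open>step\<close>; \<open>j < k\<close> keeps the truncated subtraction exact.\<close>
      then have "k - 1 + 2 = k + 2 - 1" by simp
      then show ?thesis using 3 k step[of "k + 2"] nth[of k] nth[of "k - 1"] by auto
    qed
  qed
  moreover have "length (remove_wedge j \<alpha>) = 2 * (N - 1) + 1"
    using len jN by (auto simp: remove_wedge_def min_def)
  ultimately show ?thesis
    using nth[of 0] jN ends last by (auto simp: dyck_paths_def)
qed

lemma has_fusion_limit_scale:
  assumes "has_fusion_limit h n j f g"
  shows "has_fusion_limit h n j (\<lambda>x. c * f x) (\<lambda>x. c * g x)"
  unfolding has_fusion_limit_def
proof (intro ballI allI impI)
  fix x \<xi>
  assume "x \<in> chamber n" "1 < j \<longrightarrow> x (j - 1) < \<xi>" "j + 2 \<le> n \<longrightarrow> \<xi> < x (j + 2)"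
  then have "((\<lambda>(s, t). f (x(j := s, j + 1 := t)) / of_real ((t - s) powr (- 2 * h)))
      \<longlongrightarrow> g (remove_pair j x)) (at (\<xi>, \<xi>) within {(s, t). s < t})"
    using assms unfolding has_fusion_limit_def by blast
  from tendsto_mult_left[OF this, of c]
  show "((\<lambda>(s, t). c * f (x(j := s, j + 1 := t)) / of_real ((t - s) powr (- 2 * h)))
      \<longlongrightarrow> c * g (remove_pair j x)) (at (\<xi>, \<xi>) within {(s, t). s < t})"
    by (simp add: case_prod_unfold)
qed

text \<open>The total function \<open>Gamma\<close> vanishes only at its poles, where it takes the
  default value 0, and these are integers.\<close>

lemma Gamma_irrational_nonzero:
  fixes x :: real
  assumes "x \<notin> \<rat>"
  shows "Gamma x \<noteq> 0"
  using assms nonpos_Ints_subset_Ints Ints_subset_Rats by (auto simp: Gamma_eq_zero_iff)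

lemma fusion_constant_nonzero:
  fixes \<kappa> :: real
  assumes "\<kappa> \<notin> \<rat>"
  shows "(Gamma (1 - 4 / \<kappa>))\<^sup>2 / Gamma (2 - 8 / \<kappa>) \<noteq> 0"
proof -
  \<comment> \<open>Solving for \<open>\<kappa>\<close> shows that both Gamma arguments inherit its
    irrationality. The denominator matters too: at a pole the quotient would be 0 by
    convention.\<close>
  have "\<kappa> \<in> \<rat>" if "a - b / \<kappa> \<in> \<rat>" "a \<in> \<rat>" "b \<in> \<rat>" "b \<noteq> 0" for a b :: real
  proof (cases "\<kappa> = 0")
    case False
    then have "\<kappa> = b / (a - (a - b / \<kappa>))" using that(4) by simp
    also have "\<dots> \<in> \<rat>" by (intro Rats_divide Rats_diff that)
    finally show ?thesis .
  qed simp
  from this[of 1 4] this[of 2 8] assms have "1 - 4 / \<kappa> \<notin> \<rat>" "2 - 8 / \<kappa> \<notin> \<rat>"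
    by auto
  then show ?thesis by (simp add: Gamma_irrational_nonzero)
qed

theorem theorem2:
  fixes \<kappa> h B :: real and q :: complex
    and u :: "nat list \<Rightarrow> tensor"
    and \<F> :: "nat \<Rightarrow> tensor \<Rightarrow> (nat \<Rightarrow> real) \<Rightarrow> complex"
    and \<U> :: "nat list \<Rightarrow> (nat \<Rightarrow> real) \<Rightarrow> complex"
  assumes kappa: "0 < \<kappa>" "\<kappa> < 8" "\<kappa> \<notin> \<rat>"
    and h: "h = (6 - \<kappa>) / (2 * \<kappa>)"
    and q: "q = exp (4 * of_real pi * \<i> / of_real \<kappa>)"
    and B: "B = (Gamma (1 - 4 / \<kappa>))\<^sup>2 / Gamma (2 - 8 / \<kappa>)"
    and u: "wedge_vectors q u"
    and F_iso: "\<And>N. linear_iso (H0 q (2 * N)) (solution_space \<kappa> h N) (\<F> N)"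
    and F_limit: "\<And>N v j. N \<ge> 1 \<Longrightarrow> v \<in> H0 q (2 * N) \<Longrightarrow> j \<in> {1..2 * N - 1} \<Longrightarrow>
      has_fusion_limit h (2 * N) j (\<F> N v)
        (\<lambda>y. of_real B * \<F> (N - 1) (pi_hat_at q (2 * N) j v) y)"
    and U: "\<And>N \<alpha>. \<alpha> \<in> dyck_paths N \<Longrightarrow> \<U> \<alpha> = (\<lambda>x. 1 / of_real B ^ N * \<F> N (u \<alpha>) x)"
  shows "\<forall>N. \<forall>\<alpha>\<in>dyck_paths N.
    satisfies_PDEs \<kappa> h (2 * N) (\<U> \<alpha>) \<and>
    satisfies_COV h (2 * N) (\<U> \<alpha>) \<and>
    (\<forall>j\<in>{1..2 * N - 1}.
       (has_slope \<alpha> j \<longrightarrow> has_fusion_limit h (2 * N) j (\<U> \<alpha>) (\<lambda>y. 0)) \<and>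
       (has_up_wedge \<alpha> j \<longrightarrow>
          has_fusion_limit h (2 * N) j (\<U> \<alpha>) (\<U> (remove_wedge j \<alpha>))) \<and>
       (has_down_wedge \<alpha> j \<longrightarrow>
          has_fusion_limit h (2 * N) j (\<U> \<alpha>)
            (\<lambda>y. - (qnum q (\<alpha> ! j + 1) / qnum q (\<alpha> ! j + 2)) * \<U> (remove_wedge j \<alpha>) y)))"
proof (intro allI ballI conjI impI)
  fix N \<alpha>
  assume \<alpha>: "\<alpha> \<in> dyck_paths N"
  have u\<alpha>: "u \<alpha> \<in> H0 q (2 * N)"
    using u \<alpha> by (auto simp: wedge_vectors_def)
  \<comment> \<open>With the scalar moved inside \<open>\<F>\<close>, closure of the solution space
    under scaling need not be proved.\<close>
  have "\<U> \<alpha> = \<F> N (\<lambda>w. 1 / of_real B ^ N * u \<alpha> w)"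
    unfolding U[OF \<alpha>] linear_iso_scale[OF F_iso u\<alpha>] ..
  then have sol: "\<U> \<alpha> \<in> solution_space \<kappa> h N"
    by (metis linear_iso_mem[OF F_iso scale_in_H0[OF u\<alpha>]])
  then show "satisfies_PDEs \<kappa> h (2 * N) (\<U> \<alpha>)" "satisfies_COV h (2 * N) (\<U> \<alpha>)"
    by (simp_all add: solution_space_def)
  fix j
  assume j: "j \<in> {1..2 * N - 1}"
  then have N: "N \<ge> 1" by auto
  have B0: "B \<noteq> 0"
    unfolding B by (rule fusion_constant_nonzero) (rule kappa)
  \<comment> \<open>What remains is the normalisation of \<open>\<U>\<close> on
    \<open>dyck_paths (N - 1)\<close>, so \<open>lim\<close> can be folded back into
    \<open>\<U>\<close> in the wedge cases.\<close>
  have "1 / of_real B ^ N * (of_real B * y) = 1 / of_real B ^ (N - 1) * y" for y :: complex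
    using N B0 by (cases N) auto
  with has_fusion_limit_scale[OF F_limit[OF N u\<alpha> j], of "1 / of_real B ^ N"]
  have lim: "has_fusion_limit h (2 * N) j (\<U> \<alpha>)
      (\<lambda>y. 1 / of_real B ^ (N - 1) * \<F> (N - 1) (pi_hat_at q (2 * N) j (u \<alpha>)) y)"
    by (simp only: U[OF \<alpha>])
  { assume "has_slope \<alpha> j"
    then have "pi_hat_at q (2 * N) j (u \<alpha>) = (\<lambda>w. 0)"
      using u N \<alpha> j by (auto simp: wedge_vectors_def)
    with lim show "has_fusion_limit h (2 * N) j (\<U> \<alpha>) (\<lambda>y. 0)"
      by (simp only: linear_iso_H0_zero[OF F_iso] mult_zero_right) }
  { assume w: "has_up_wedge \<alpha> j"
    then have "remove_wedge j \<alpha> \<in> dyck_paths (N - 1)"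
      by (intro remove_wedge_dyck[OF \<alpha> j]) (simp add: has_up_wedge_def)
    moreover have "pi_hat_at q (2 * N) j (u \<alpha>) = u (remove_wedge j \<alpha>)"
      using u N \<alpha> j w by (auto simp: wedge_vectors_def)
    ultimately show "has_fusion_limit h (2 * N) j (\<U> \<alpha>) (\<U> (remove_wedge j \<alpha>))"
      using lim by (simp only: U[of _ "N - 1"]) }
  { assume w: "has_down_wedge \<alpha> j"
    let ?c = "- (qnum q (\<alpha> ! j + 1) / qnum q (\<alpha> ! j + 2))"
    have r: "remove_wedge j \<alpha> \<in> dyck_paths (N - 1)"
      using w by (intro remove_wedge_dyck[OF \<alpha> j]) (simp add: has_down_wedge_def)
    \<comment> \<open>The coefficient can be pulled out of \<open>\<F> (N - 1)\<close> only for
      vectors in its domain.\<close>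
    then have ur: "u (remove_wedge j \<alpha>) \<in> H0 q (2 * (N - 1))"
      using u by (auto simp: wedge_vectors_def)
    have "pi_hat_at q (2 * N) j (u \<alpha>) = (\<lambda>w. ?c * u (remove_wedge j \<alpha>) w)"
      using u N \<alpha> j w unfolding wedge_vectors_def by blast
    then have "\<F> (N - 1) (pi_hat_at q (2 * N) j (u \<alpha>)) = (\<lambda>y. ?c * \<F> (N - 1) (u (remove_wedge j \<alpha>)) y)"
      by (simp only: linear_iso_scale[OF F_iso ur])
    with lim show "has_fusion_limit h (2 * N) j (\<U> \<alpha>) (\<lambda>y. ?c * \<U> (remove_wedge j \<alpha>) y)"
      by (simp only: U[OF r] mult.left_commute) }
qed

end
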